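(* Let $H$ be a real Hilbert space, $T:H\rightrightarrows H$ maximal monotone, $\sigma\in(0,1)$, $z_0\in H$, and let $(z_k)_{k\ge 0}$, $(\tilde z_k)_{k\ge1}$, $(v_k)_{k\ge1}$, $(\varepsilon_k)_{k\ge1}$, $(\lambda_k)_{k\ge1}$, $(t_k)_{k\ge1}$ be sequences generated by the relaxed HPE method (as defined in the context) from $z_0$ with parameter $\sigma$. Then for any $k\ge1$ and any $z^*\in T^{-1}(0)$: 1. $(1-\sigma)\|\tilde z_k-z_{k-1}\|\le\|\lambda_kv_k\|\le(1+\sigma)\|\tilde z_k-z_{k-1}\|$ and $2\lambda_k\varepsilon_k\le\sigma^2\|\tilde z_k-z_{k-1}\|^2$; 2. $\|z^*-z_{k-1}\|^2\ge\|z^*-z_k\|^2+t_k(1-\sigma^2)\|\tilde z_k-z_{k-1}\|^2\ge\|z^*-z_k\|^2$; 3. $\|z^*-z_0\|^2\ge\|z^*-z_k\|^2+(1-\sigma^2)\sum_{j=1}^k t_j\|\tilde z_j-z_{j-1}\|^2$; 4. $\|z^*-\tilde z_k\|\le\|z^*-z_{k-1}\|/\sqrt{1-\sigma^2}$ and $\|\tilde z_k-z_{k-1}\|\le\|z^*-z_{k-1}\|/\sqrt{1-\sigma^2}$.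
   Context: A point-to-set operator $T:H\rightrightarrows H$ is a relation $T\subset H\times H$, with $T(z)=\{v : (z,v)\in T\}$ and $T^{-1}(0)=\{z : 0\in T(z)\}$. It is monotone if $\langle z-z',v-v'\rangle\ge0$ for all $(z,v),(z',v')\in T$, and maximal monotone if it is maximal, with respect to inclusion, among monotone operators. For $\varepsilon\ge0$ the $\varepsilon$-enlargement of $T$ is $T^{[\varepsilon]}(z)=\{v : \langle z-z',v-v'\rangle\ge-\varepsilon\ \ \forall (z',v')\in T\}$, $z\in H$. Relaxed HPE (r-HPE) method: given $z_0\in H$ and $\sigma\in(0,1)$, for each $k=1,2,\dots$ one has $\tilde z_k,v_k\in H$, $\varepsilon_k\ge0$, $\lambda_k>0$ such that $$v_k\in T^{[\varepsilon_k]}(\tilde z_k),\qquad \|\lambda_kv_k+\tilde z_k-z_{k-1}\|^2+2\lambda_k\varepsilon_k\le\sigma^2\|\tilde z_k-z_{k-1}\|^2,$$ and $t_k\in(0,1]$, and $z_k=z_{k-1}-t_k\lambda_kv_k$. *)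

theory Defs
  imports "HOL-Analysis.Analysis"
begin

text \<open>
  A point-to-set operator on \<open>H\<close> is a relation \<open>T\<close> of type \<open>('a \<times> 'a) set\<close>, so that
  \<open>T(z)\<close> is \<open>T `` {z}\<close> and \<open>T\<close>'s inverse image of 0 is \<open>T\<inverse> `` {0}\<close>.
  Real Hilbert spaces are the types of sort \<open>{real_inner, complete_space}\<close>.
\<close>

definition monotone_op :: "('a::real_inner \<times> 'a) set \<Rightarrow> bool" where
  "monotone_op T \<longleftrightarrow> (\<forall>(z, v)\<in>T. \<forall>(z', v')\<in>T. inner (z - z') (v - v') \<ge> 0)"

definition maximal_monotone_op :: "('a::real_inner \<times> 'a) set \<Rightarrow> bool" where
  "maximal_monotone_op T \<longleftrightarrow> monotone_op T \<and> (\<forall>S. monotone_op S \<and> T \<subseteq> S \<longrightarrow> S = T)"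

definition enlargement :: "('a::real_inner \<times> 'a) set \<Rightarrow> real \<Rightarrow> 'a \<Rightarrow> 'a set" where
  "enlargement T \<epsilon> z = {v. \<forall>(z', v')\<in>T. inner (z - z') (v - v') \<ge> - \<epsilon>}"

text \<open>
  In the following, \<open>zt k\<close> is the auxiliary point \<open>z\<close>-tilde of step \<open>k\<close>. The sequences
  \<open>zt\<close>, \<open>v\<close>, \<open>\<epsilon>\<close>, \<open>lam\<close>, \<open>t\<close> start at index 1; their values at index 0 are unconstrained.
\<close>

definition relaxed_HPE ::
  "('a::real_inner \<times> 'a) set \<Rightarrow> real \<Rightarrow> 'a \<Rightarrow> (nat \<Rightarrow> 'a) \<Rightarrow> (nat \<Rightarrow> 'a) \<Rightarrow> (nat \<Rightarrow> 'a)
    \<Rightarrow> (nat \<Rightarrow> real) \<Rightarrow> (nat \<Rightarrow> real) \<Rightarrow> (nat \<Rightarrow> real) \<Rightarrow> bool" where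
  "relaxed_HPE T \<sigma> z0 z zt v \<epsilon> lam t \<longleftrightarrow>
     z 0 = z0 \<and>
     (\<forall>k\<ge>1.
        \<epsilon> k \<ge> 0 \<and> lam k > 0 \<and>
        v k \<in> enlargement T (\<epsilon> k) (zt k) \<and>
        (norm (lam k *\<^sub>R v k + zt k - z (k - 1)))\<^sup>2 + 2 * lam k * \<epsilon> k
          \<le> \<sigma>\<^sup>2 * (norm (zt k - z (k - 1)))\<^sup>2 \<and>
        0 < t k \<and> t k \<le> 1 \<and>
        z k = z (k - 1) - (t k * lam k) *\<^sub>R v k)"

end

theory Submission
  imports Defs
begin

text \<open>
  Every estimate concerns a single step. Put \<open>x = z\<^sub>k\<^sub>-\<^sub>1\<close>, let \<open>y\<close> be the auxiliary point,
  \<open>w = \<lambda>\<^sub>k v\<^sub>k\<close> and \<open>e = \<lambda>\<^sub>k \<epsilon>\<^sub>k\<close>. The operator enters through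
  \<open>\<langle>y - s, w\<rangle> \<ge> - e\<close> for each zero \<open>s\<close>, which is \<open>\<lambda>\<^sub>k\<close> times the enlargement inequality tested on the pair
  \<open>(s, 0)\<close> of the graph.

  Expanding the residual \<open>\<parallel>w + y - x\<parallel>\<^sup>2\<close> shows that the relative error criterion and this
  inequality add up to \<open>2\<langle>x - s, w\<rangle> \<ge> \<parallel>w\<parallel>\<^sup>2 + (1 - \<sigma>\<^sup>2)\<parallel>y - x\<parallel>\<^sup>2\<close>. Hence moving from \<open>x\<close> along
  \<open>- w\<close>, by any fraction \<open>\<tau> \<le> 1\<close> of the full step, brings the point closer to \<open>s\<close>, with a gain
  proportional to \<open>\<tau>\<close> (\<open>relaxed_step_decrease\<close>); this is the second claim, and summing it over
  the steps gives the third.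

  The fourth claim bounds \<open>y\<close>, which does not depend on the relaxation, so it can be derived from
  the full step \<open>x - w\<close> even though the method need not take that step. The point \<open>y\<close> lies within
  \<open>\<sigma>\<parallel>y - x\<parallel>\<close> of \<open>x - w\<close>, and the Cauchy-Schwarz inequality in the plane combines this with the
  decrease for \<open>\<tau> = 1\<close> (\<open>auxiliary_point_dist_le\<close>).
\<close>

text \<open>
  The residual is the sum of \<open>w\<close> and \<open>y - x\<close>; if it is small relative to \<open>y - x\<close>, the two
  summands nearly cancel and so have comparable norms.
\<close>

lemma relative_error_norm_bounds:
  fixes x y w :: "'a::real_normed_vector"
  assumes "norm (w + y - x) \<le> \<sigma> * norm (y - x)"
  shows "(1 - \<sigma>) * norm (y - x) \<le> norm w"
    and "norm w \<le> (1 + \<sigma>) * norm (y - x)"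
proof -
  have "norm (y - x) \<le> norm (w + y - x) + norm w"
    using norm_triangle_ineq4[of "w + y - x" w] by simp
  then show "(1 - \<sigma>) * norm (y - x) \<le> norm w"
    using assms by (simp add: algebra_simps)
  have "norm w \<le> norm (w + y - x) + norm (y - x)"
    using norm_triangle_ineq4[of "w + y - x" "y - x"] by simp
  then show "norm w \<le> (1 + \<sigma>) * norm (y - x)"
    using assms by (simp add: algebra_simps)
qed

text \<open>
  The case \<open>\<tau> = 1\<close> is the identity
  \<open>2\<langle>x - s, w\<rangle> - \<parallel>w\<parallel>\<^sup>2 = 2\<langle>y - s, w\<rangle> - \<parallel>w + y - x\<parallel>\<^sup>2 + \<parallel>y - x\<parallel>\<^sup>2\<close> combined with the hypotheses.
  A shorter step loses nothing beyond the factor \<open>\<tau>\<close>, because the quadratic term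
  \<open>\<tau>\<^sup>2\<parallel>w\<parallel>\<^sup>2\<close> is at most \<open>\<tau>\<parallel>w\<parallel>\<^sup>2\<close>.
\<close>

lemma relaxed_step_decrease:
  fixes x y w s :: "'a::real_inner"
  assumes sep: "- e \<le> inner (y - s) w"
    and err: "(norm (w + y - x))\<^sup>2 + 2 * e \<le> \<sigma>\<^sup>2 * (norm (y - x))\<^sup>2"
    and "0 \<le> \<tau>" "\<tau> \<le> 1"
  shows "(norm (s - (x - \<tau> *\<^sub>R w)))\<^sup>2 + \<tau> * (1 - \<sigma>\<^sup>2) * (norm (y - x))\<^sup>2 \<le> (norm (s - x))\<^sup>2"
proof -
  have "2 * inner (x - s) w - (norm w)\<^sup>2
      = 2 * inner (y - s) w - (norm (w + y - x))\<^sup>2 + (norm (y - x))\<^sup>2"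
    by (simp add: power2_norm_eq_inner inner_diff inner_add inner_commute algebra_simps)
  then have "(norm w)\<^sup>2 + (1 - \<sigma>\<^sup>2) * (norm (y - x))\<^sup>2 \<le> 2 * inner (x - s) w"
    using sep err by (simp add: algebra_simps)
  from mult_left_mono[OF this \<open>0 \<le> \<tau>\<close>]
  have gain: "\<tau> * (norm w)\<^sup>2 + \<tau> * (1 - \<sigma>\<^sup>2) * (norm (y - x))\<^sup>2 \<le> 2 * \<tau> * inner (x - s) w"
    by (simp add: algebra_simps)
  have "\<tau>\<^sup>2 \<le> \<tau>"
    using \<open>0 \<le> \<tau>\<close> \<open>\<tau> \<le> 1\<close> by (simp add: power2_eq_square mult_left_le)
  then have "\<tau>\<^sup>2 * (norm w)\<^sup>2 \<le> \<tau> * (norm w)\<^sup>2"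
    by (intro mult_right_mono) auto
  moreover have "(norm (s - (x - \<tau> *\<^sub>R w)))\<^sup>2
      = (norm (s - x))\<^sup>2 - 2 * \<tau> * inner (x - s) w + \<tau>\<^sup>2 * (norm w)\<^sup>2"
    unfolding power2_norm_eq_inner
    by (simp add: inner_diff inner_add inner_commute power2_eq_square algebra_simps)
  ultimately show ?thesis
    using gain by linarith
qed

text \<open>
  The full-step decrease bounds \<open>\<parallel>s - (x - w)\<parallel>\<^sup>2 + (1 - \<sigma>\<^sup>2)\<parallel>y - x\<parallel>\<^sup>2\<close>. For the second bound the
  first term can be dropped. For the first bound, the triangle inequality through \<open>x - w\<close> uses both
  distances, and bounding them separately would give a larger constant, so they are weighed against
  each other by the Cauchy-Schwarz inequality.
\<close>

lemma auxiliary_point_dist_le: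
  fixes x y w s :: "'a::real_inner"
  assumes sep: "- e \<le> inner (y - s) w"
    and err: "(norm (w + y - x))\<^sup>2 + 2 * e \<le> \<sigma>\<^sup>2 * (norm (y - x))\<^sup>2"
    and res: "norm (w + y - x) \<le> \<sigma> * norm (y - x)"
    and "0 \<le> \<sigma>" "\<sigma> < 1"
  shows "norm (s - y) \<le> norm (s - x) / sqrt (1 - \<sigma>\<^sup>2)"
    and "norm (y - x) \<le> norm (s - x) / sqrt (1 - \<sigma>\<^sup>2)"
proof -
  define c where "c = 1 - \<sigma>\<^sup>2"
  define A where "A = norm (s - (x - w))"
  define D where "D = norm (y - x)"
  have "c > 0"
    using \<open>0 \<le> \<sigma>\<close> \<open>\<sigma> < 1\<close> by (simp add: c_def power_less_one_iff)
  have full: "A\<^sup>2 + c * D\<^sup>2 \<le> (norm (s - x))\<^sup>2"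
    using relaxed_step_decrease[OF sep err, of 1] by (simp add: A_def D_def c_def)
  have div_sqrt: "a \<le> norm (s - x) / sqrt c" if "c * a\<^sup>2 \<le> (norm (s - x))\<^sup>2" for a
  proof -
    have "(sqrt c * a)\<^sup>2 \<le> (norm (s - x))\<^sup>2"
      using that \<open>c > 0\<close> by (simp add: power_mult_distrib)
    then have "sqrt c * a \<le> norm (s - x)"
      by (rule power2_le_imp_le) simp
    then show ?thesis
      using \<open>c > 0\<close> by (simp add: pos_le_divide_eq mult.commute)
  qed
  have "c * D\<^sup>2 \<le> (norm (s - x))\<^sup>2"
    using full zero_le_power2[of A] by linarith
  then show "norm (y - x) \<le> norm (s - x) / sqrt (1 - \<sigma>\<^sup>2)"
    using div_sqrt unfolding c_def D_def by blast
  have "norm (s - y) \<le> A + norm (w + y - x)"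
    using norm_triangle_ineq4[of "s - (x - w)" "w + y - x"] by (simp add: A_def)
  then have "norm (s - y) \<le> A + \<sigma> * D"
    using res by (simp add: D_def)
  then have "c * (norm (s - y))\<^sup>2 \<le> c * (A + \<sigma> * D)\<^sup>2"
    using \<open>c > 0\<close> by (intro mult_left_mono power_mono) auto
  \<comment> \<open>Cauchy-Schwarz for \<open>(A, sqrt c * D)\<close> and \<open>(1, \<sigma> / sqrt c)\<close>, with its defect written as a square\<close>
  also have "c * (A + \<sigma> * D)\<^sup>2 = A\<^sup>2 + c * D\<^sup>2 - (\<sigma> * A - c * D)\<^sup>2"
    unfolding c_def by algebra
  also have "\<dots> \<le> (norm (s - x))\<^sup>2"
    using full zero_le_power2[of "\<sigma> * A - c * D"] by linarith
  finally show "norm (s - y) \<le> norm (s - x) / sqrt (1 - \<sigma>\<^sup>2)"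
    using div_sqrt unfolding c_def by blast
qed

theorem proposition2p2:
  fixes T :: "('a::{real_inner, complete_space} \<times> 'a) set"
    and \<sigma> :: real and z0 :: 'a
    and z zt v :: "nat \<Rightarrow> 'a"
    and \<epsilon> lam t :: "nat \<Rightarrow> real"
  assumes "maximal_monotone_op T"
    and "0 < \<sigma>" and "\<sigma> < 1"
    and "relaxed_HPE T \<sigma> z0 z zt v \<epsilon> lam t"
  shows "\<forall>k\<ge>1.
    ((1 - \<sigma>) * norm (zt k - z (k - 1)) \<le> norm (lam k *\<^sub>R v k) \<and>
     norm (lam k *\<^sub>R v k) \<le> (1 + \<sigma>) * norm (zt k - z (k - 1)) \<and>
     2 * lam k * \<epsilon> k \<le> \<sigma>\<^sup>2 * (norm (zt k - z (k - 1)))\<^sup>2) \<and>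
    (\<forall>zs \<in> T\<inverse> `` {0}.
      ((norm (zs - z (k - 1)))\<^sup>2
         \<ge> (norm (zs - z k))\<^sup>2 + t k * (1 - \<sigma>\<^sup>2) * (norm (zt k - z (k - 1)))\<^sup>2 \<and>
       (norm (zs - z k))\<^sup>2 + t k * (1 - \<sigma>\<^sup>2) * (norm (zt k - z (k - 1)))\<^sup>2
         \<ge> (norm (zs - z k))\<^sup>2) \<and>
      (norm (zs - z0))\<^sup>2
        \<ge> (norm (zs - z k))\<^sup>2
          + (1 - \<sigma>\<^sup>2) * (\<Sum>j=1..k. t j * (norm (zt j - z (j - 1)))\<^sup>2) \<and>
      (norm (zs - zt k) \<le> norm (zs - z (k - 1)) / sqrt (1 - \<sigma>\<^sup>2) \<and>
       norm (zt k - z (k - 1)) \<le> norm (zs - z (k - 1)) / sqrt (1 - \<sigma>\<^sup>2)))"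
proof -
  define w where "w k = lam k *\<^sub>R v k" for k
  define e where "e k = lam k * \<epsilon> k" for k
  have z_0: "z 0 = z0"
    using assms(4) by (simp add: relaxed_HPE_def)
  have e_nonneg: "0 \<le> e k"
    and enl: "v k \<in> enlargement T (\<epsilon> k) (zt k)" and lam_pos: "0 < lam k"
    and err: "(norm (w k + zt k - z (k - 1)))\<^sup>2 + 2 * e k \<le> \<sigma>\<^sup>2 * (norm (zt k - z (k - 1)))\<^sup>2"
    and t_bounds: "0 \<le> t k" "t k \<le> 1"
    and z_step: "z k = z (k - 1) - t k *\<^sub>R w k" if "k \<ge> 1" for k
    using assms(4) that by (auto simp: relaxed_HPE_def w_def e_def mult.assoc)
  have res: "norm (w k + zt k - z (k - 1)) \<le> \<sigma> * norm (zt k - z (k - 1))" if "k \<ge> 1" for k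
  proof (rule power2_le_imp_le)
    show "(norm (w k + zt k - z (k - 1)))\<^sup>2 \<le> (\<sigma> * norm (zt k - z (k - 1)))\<^sup>2"
      using err[OF that] e_nonneg[OF that] by (simp add: power_mult_distrib)
  qed (use assms(2) in simp)
  have eps: "2 * lam k * \<epsilon> k \<le> \<sigma>\<^sup>2 * (norm (zt k - z (k - 1)))\<^sup>2" if "k \<ge> 1" for k
    using err[OF that] zero_le_power2[of "norm (w k + zt k - z (k - 1))"]
    unfolding e_def mult.assoc by linarith
  have "\<sigma>\<^sup>2 \<le> 1"
    using assms(2,3) by (simp add: power_le_one)
  have sep: "- e k \<le> inner (zt k - zs) (w k)" if "k \<ge> 1" "(zs, 0) \<in> T" for k zs
  proof -
    have "- \<epsilon> k \<le> inner (zt k - zs) (v k)"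
      using enl[OF that(1)] that(2) by (force simp: enlargement_def)
    from mult_left_mono[OF this, of "lam k"] show ?thesis
      using lam_pos[OF that(1)] by (simp add: e_def w_def)
  qed
  have decrease: "(norm (zs - z k))\<^sup>2 + t k * (1 - \<sigma>\<^sup>2) * (norm (zt k - z (k - 1)))\<^sup>2
      \<le> (norm (zs - z (k - 1)))\<^sup>2" if "k \<ge> 1" "(zs, 0) \<in> T" for k zs
    using relaxed_step_decrease[OF sep[OF that] err[OF that(1)] t_bounds[OF that(1)]]
    by (simp only: z_step[OF that(1), symmetric])
  have total: "(norm (zs - z k))\<^sup>2 + (1 - \<sigma>\<^sup>2) * (\<Sum>j=1..k. t j * (norm (zt j - z (j - 1)))\<^sup>2)
      \<le> (norm (zs - z0))\<^sup>2" if "(zs, 0) \<in> T" for k zs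
  proof (induction k)
    case 0
    show ?case by (simp add: z_0)
  next
    case (Suc k)
    have "(norm (zs - z (Suc k)))\<^sup>2 + (1 - \<sigma>\<^sup>2) * (t (Suc k) * (norm (zt (Suc k) - z k))\<^sup>2)
        \<le> (norm (zs - z k))\<^sup>2"
      using decrease[of "Suc k" zs] that by (simp add: mult_ac)
    with Suc.IH show ?case
      by (simp add: distrib_left)
  qed
  show ?thesis
  proof (intro allI impI conjI ballI)
    fix k :: nat assume k: "k \<ge> 1"
    show "(1 - \<sigma>) * norm (zt k - z (k - 1)) \<le> norm (lam k *\<^sub>R v k)"
      "norm (lam k *\<^sub>R v k) \<le> (1 + \<sigma>) * norm (zt k - z (k - 1))"
      using relative_error_norm_bounds[OF res[OF k]] by (simp_all only: w_def)
    show "2 * lam k * \<epsilon> k \<le> \<sigma>\<^sup>2 * (norm (zt k - z (k - 1)))\<^sup>2"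
      by (rule eps[OF k])
    fix zs assume "zs \<in> T\<inverse> `` {0}"
    then have zero: "(zs, 0) \<in> T" by simp
    show "(norm (zs - z k))\<^sup>2 + t k * (1 - \<sigma>\<^sup>2) * (norm (zt k - z (k - 1)))\<^sup>2
        \<le> (norm (zs - z (k - 1)))\<^sup>2"
      by (rule decrease[OF k zero])
    show "(norm (zs - z k))\<^sup>2
        \<le> (norm (zs - z k))\<^sup>2 + t k * (1 - \<sigma>\<^sup>2) * (norm (zt k - z (k - 1)))\<^sup>2"
      using t_bounds[OF k] \<open>\<sigma>\<^sup>2 \<le> 1\<close> by simp
    show "(norm (zs - z k))\<^sup>2 + (1 - \<sigma>\<^sup>2) * (\<Sum>j=1..k. t j * (norm (zt j - z (j - 1)))\<^sup>2)
        \<le> (norm (zs - z0))\<^sup>2"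
      by (rule total[OF zero])
    note aux = auxiliary_point_dist_le[OF sep[OF k zero] err[OF k] res[OF k]
        less_imp_le[OF assms(2)] assms(3)]
    show "norm (zs - zt k) \<le> norm (zs - z (k - 1)) / sqrt (1 - \<sigma>\<^sup>2)"
      by (rule aux(1))
    show "norm (zt k - z (k - 1)) \<le> norm (zs - z (k - 1)) / sqrt (1 - \<sigma>\<^sup>2)"
      by (rule aux(2))
  qed
qed

end
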